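(* Suppose $\vec K$-$\mathsf{SCFA}$ holds for some adequate model sequence $\vec K$. Then $\mathsf{SCFA}$ holds.
   Context: **Models.** $\mathcal L_{\mathrm{ST}}=\{\in\}$ and $\mathcal L_{\mathrm{ST}}^+=\{\in,\tilde P\}$ with $\tilde P$ a unary predicate. $\mathrm{ZF}^-$, $\mathrm{ZFC}^-$ are $\mathrm{ZF}$, $\mathrm{ZFC}$ without Power Set (for $\mathcal L_{\mathrm{ST}}^+$-structures, Separation and Replacement are for all $\mathcal L_{\mathrm{ST}}^+$-formulas). Structures are identified with their universes; a structure is transitive if its universe is a transitive set and its membership relation is the true $\in$. $\sigma:M\prec N$ means $\sigma$ is an elementary embedding of $M$ into $N$. For a set $A$ and ordinal $\chi$, $L^A_\chi=\langle L_\chi[A],\in,A\cap L_\chi[A]\rangle$. A transitive $\mathcal L_{\mathrm{ST}}^+$-model $M$ of $\mathrm{ZFC}^-$ is *full* if there is a transitive $\mathcal L_{\mathrm{ST}}$-model $N$ of $\mathrm{ZF}^-$ with $M\in N$ such that for all $x\in M$ and all $f:x\to M$ with $f\in N$ we have $f\in M$. **Model sequences.** $\vec K=\langle K_\xi\mid\xi<\omega_1\rangle$ is an *adequate model sequence* if (i) each $K_\xi$ is a transitive (set) $\mathcal L_{\mathrm{ST}}$-model of $\mathrm{ZFC}^-$, $\xi\in K_\xi$ and $\xi$ is countable in $K_\xi$; (ii) for every $B\subseteq\omega_1$ there are stationarily many $\xi<\omega_1$ with $B\cap\xi\in K_\xi$. A *$\vec K$-good model* is a transitive full $\mathcal L_{\mathrm{ST}}^+$-model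 $\bar M$ of $\mathrm{ZFC}^-$ such that $\bar M\in K_{\omega_1^{\bar M}}$ and $\bar M$ is countable in $K_{\omega_1^{\bar M}}$. **$\vec K$-subcompleteness.** A forcing notion is a separative preorder with a largest element. A regular cardinal $\theta$ and $a\in\mathcal H_\theta$ *verify the $\vec K$-subcompleteness* of a forcing notion $\mathbb P$ if $\mathbb P\in\mathcal H_\theta$ and for all $A,\chi,\bar M,\bar{\mathbb P},\bar b,\sigma,b,\bar G$: if (i) $A$ is a set, $\chi$ is an ordinal, $\mathcal H_\theta\subseteq L^A_\chi\models\mathrm{ZFC}^-$; (ii) $\bar M$ is a $\vec K$-good model with $\bar{\mathbb P},\bar b\in\bar M$; (iii) $\sigma:\bar M\prec L^A_\chi$, $a\in\mathrm{ran}(\sigma)$, $\sigma(\langle\bar{\mathbb P},\bar b\rangle)=\langle\mathbb P,b\rangle$; (iv) $\bar G$ is a $\bar{\mathbb P}$-generic filter over $\bar M$ with $\bar G\in K_{\omega_1^{\bar M}}$; then there is $p^*\in\mathbb P$ forcing that there is $\sigma^*:\bar M\prec L^A_\chi$ with $\sigma^*(\langle\bar{\mathbb P},\bar b\rangle)=\langle\mathbb P,b\rangle$ and $\sigma^*[\bar G]\subseteq\dot G$, where $\dot G$ is the canonical name for the generic filter. $\mathbb P$ is *$\vec K$-subcomplete* if some regular $\theta$ and $a\in\mathcal H_\theta$ verify this. **Subcompleteness (Jensen).** For a forcing notion $\mathbb P$ let $\delta(\mathbb P)$ be the least cardinality of a dense subset of $\mathbb P$; for $M=L^A_\chi\models\mathrm{ZFC}^-$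 and $X\subseteq M$ let $\mathrm{Hull}^M(X)$ be the Skolem hull of $X$ in $M$, i.e. the set of elements of $M$ definable in $M$ from parameters in $X$. $\mathbb P$ is *subcomplete* if there are a regular cardinal $\theta$ and $a\in\mathcal H_\theta$ with $\mathbb P\in\mathcal H_\theta$ such that for all $A,\chi,\bar M,\bar{\mathbb P},\bar b,\sigma,b,\bar G$: if $A$ is a set, $\chi$ is an ordinal, $\mathcal H_\theta\subseteq M:=L^A_\chi\models\mathrm{ZFC}^-$; $\bar M$ is a countable transitive full $\mathcal L^+_{\mathrm{ST}}$-model of $\mathrm{ZFC}^-$ with $\bar{\mathbb P},\bar b\in\bar M$; $\sigma:\bar M\prec M$, $a\in\mathrm{ran}(\sigma)$, $\sigma(\langle\bar{\mathbb P},\bar b\rangle)=\langle\mathbb P,b\rangle$; and $\bar G$ is a $\bar{\mathbb P}$-generic filter over $\bar M$; then there is $p^*\in\mathbb P$ forcing that there is $\sigma^*:\bar M\prec M$ with $\sigma^*(\langle\bar{\mathbb P},\bar b\rangle)=\langle\mathbb P,b\rangle$, $\sigma^*[\bar G]\subseteq\dot G$ and $\mathrm{Hull}^M(\delta(\mathbb P)\cup\mathrm{ran}(\sigma^* ))=\mathrm{Hull}^M(\delta(\mathbb P)\cup\mathrm{ran}(\sigma))$. **Forcing axioms.** $\mathsf{SCFA}$ (respectively $\vec K$-$\mathsf{SCFA}$, for an adequate model sequence $\vec K$): for any subcomplete (respectively $\vec K$-subcomplete) forcing notion $\mathbb P$ and any family $\mathcal D$ of dense subsets of $\mathbb P$ with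 $|\mathcal D|\le\omega_1$, there is a filter $g$ on $\mathbb P$ with $g\cap D\ne\emptyset$ for all $D\in\mathcal D$. *)

theory Defs
  imports Main
begin

section \<open>Set-theoretic formulas with parameters\<close>

text \<open>
  The statement is a theorem of ZFC, so it is rendered as an assertion about every model
  \<open>(V, \<epsilon>)\<close> of first-order ZFC; here \<open>V\<close> is an arbitrary type \<open>'v\<close>. All quantifiers in the
  definitions below that concern sets range over \<open>'v\<close> only, never over Isabelle sets or
  predicates on \<open>'v\<close>. In particular formulas, satisfaction, elementarity, names and the
  forcing relation are notions internal to \<open>V\<close>.

  Some notions are needed in \<open>V\<close>, in a transitive model, and in a generic extension of \<open>V\<close>. They
  are written once, as terms of type \<open>'v fm\<close>: formulas of set theory with parameters from \<open>'v\<close>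
  and with variable binding represented by Isabelle functions. They are then evaluated in \<open>V\<close>,
  relativized to a class, or forced (in which case the parameters are names). Each is a fixed
  finite formula. The type as such also has infinitary inhabitants, so the axiom
  schemas of ZFC in \<open>V\<close> use the type \<open>form\<close> of genuine first-order formulas below.
\<close>

datatype 'v fm =
    Mem 'v 'v (infix "\<^bold>\<in>" 50)
  | Eq 'v 'v (infix "\<^bold>=" 50)
  | Neg "'v fm" ("\<^bold>\<not> _" [40] 40)
  | Conj "'v fm" "'v fm" (infixr "\<^bold>\<and>" 35)
  | All "'v \<Rightarrow> 'v fm" (binder "\<^bold>\<forall>" 10)

abbreviation Disj :: "'v fm \<Rightarrow> 'v fm \<Rightarrow> 'v fm" (infixr "\<^bold>\<or>" 30) where
  "\<phi> \<^bold>\<or> \<psi> \<equiv> \<^bold>\<not> (\<^bold>\<not> \<phi> \<^bold>\<and> \<^bold>\<not> \<psi>)"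

abbreviation Imp :: "'v fm \<Rightarrow> 'v fm \<Rightarrow> 'v fm" (infixr "\<^bold>\<longrightarrow>" 25) where
  "\<phi> \<^bold>\<longrightarrow> \<psi> \<equiv> \<^bold>\<not> (\<phi> \<^bold>\<and> \<^bold>\<not> \<psi>)"

abbreviation Iff :: "'v fm \<Rightarrow> 'v fm \<Rightarrow> 'v fm" (infixr "\<^bold>\<longleftrightarrow>" 25) where
  "\<phi> \<^bold>\<longleftrightarrow> \<psi> \<equiv> (\<phi> \<^bold>\<longrightarrow> \<psi>) \<^bold>\<and> (\<psi> \<^bold>\<longrightarrow> \<phi>)"

abbreviation Ex :: "('v \<Rightarrow> 'v fm) \<Rightarrow> 'v fm" (binder "\<^bold>\<exists>" 10) where
  "\<^bold>\<exists>x. F x \<equiv> \<^bold>\<not> (\<^bold>\<forall>x. \<^bold>\<not> F x)"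

datatype form = FMem nat nat | FEq nat nat | FNeg form | FConj form form | FAll nat form

primrec inst :: "form \<Rightarrow> (nat \<Rightarrow> 'v) \<Rightarrow> 'v fm" where
  "inst (FMem i j) e = (e i \<^bold>\<in> e j)"
| "inst (FEq i j) e = (e i \<^bold>= e j)"
| "inst (FNeg \<phi>) e = (\<^bold>\<not> inst \<phi> e)"
| "inst (FConj \<phi> \<psi>) e = (inst \<phi> e \<^bold>\<and> inst \<psi> e)"
| "inst (FAll i \<phi>) e = (\<^bold>\<forall>x. inst \<phi> (e(i := x)))"


subsection \<open>Basic notions\<close>

definition is_empty :: "'v \<Rightarrow> 'v fm" where
  "is_empty x = (\<^bold>\<forall>z. \<^bold>\<not> z \<^bold>\<in> x)"

definition is_sub :: "'v \<Rightarrow> 'v \<Rightarrow> 'v fm" where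
  "is_sub x y = (\<^bold>\<forall>z. z \<^bold>\<in> x \<^bold>\<longrightarrow> z \<^bold>\<in> y)"

definition is_trans :: "'v \<Rightarrow> 'v fm" where
  "is_trans x = (\<^bold>\<forall>y. y \<^bold>\<in> x \<^bold>\<longrightarrow> is_sub y x)"

definition is_upair :: "'v \<Rightarrow> 'v \<Rightarrow> 'v \<Rightarrow> 'v fm" where
  "is_upair a b z = (\<^bold>\<forall>w. w \<^bold>\<in> z \<^bold>\<longleftrightarrow> w \<^bold>= a \<^bold>\<or> w \<^bold>= b)"

definition is_pair :: "'v \<Rightarrow> 'v \<Rightarrow> 'v \<Rightarrow> 'v fm" where
  "is_pair a b z = (\<^bold>\<exists>u. \<^bold>\<exists>v. is_upair a a u \<^bold>\<and> is_upair a b v \<^bold>\<and> is_upair u v z)"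

definition is_union :: "'v \<Rightarrow> 'v \<Rightarrow> 'v fm" where
  "is_union x u = (\<^bold>\<forall>z. z \<^bold>\<in> u \<^bold>\<longleftrightarrow> (\<^bold>\<exists>y. y \<^bold>\<in> x \<^bold>\<and> z \<^bold>\<in> y))"

definition is_succ :: "'v \<Rightarrow> 'v \<Rightarrow> 'v fm" where
  "is_succ x y = (\<^bold>\<forall>z. z \<^bold>\<in> y \<^bold>\<longleftrightarrow> z \<^bold>\<in> x \<^bold>\<or> z \<^bold>= x)"

text \<open>Under Foundation, ordinals are the transitive sets of transitive sets.\<close>

definition is_ord :: "'v \<Rightarrow> 'v fm" where
  "is_ord x = (is_trans x \<^bold>\<and> (\<^bold>\<forall>y. y \<^bold>\<in> x \<^bold>\<longrightarrow> is_trans y))"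

definition is_omega :: "'v \<Rightarrow> 'v fm" where
  "is_omega w = (is_ord w \<^bold>\<and> \<^bold>\<not> is_empty w
     \<^bold>\<and> (\<^bold>\<forall>n. n \<^bold>\<in> w \<^bold>\<longrightarrow> (\<^bold>\<exists>m. m \<^bold>\<in> w \<^bold>\<and> n \<^bold>\<in> m))
     \<^bold>\<and> (\<^bold>\<forall>n. n \<^bold>\<in> w \<^bold>\<longrightarrow> is_empty n \<^bold>\<or> (\<^bold>\<exists>m. is_succ m n)))"

primrec is_num :: "nat \<Rightarrow> 'v \<Rightarrow> 'v fm" where
  "is_num 0 x = is_empty x"
| "is_num (Suc k) x = (\<^bold>\<exists>y. is_num k y \<^bold>\<and> is_succ y x)"

text \<open>\<open>app f x y\<close> says that \<open>f\<close> contains the ordered pair \<open>\<langle>x, y\<rangle>\<close>, i.e. \<open>f(x) = y\<close> when \<open>f\<close> is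
  a function.\<close>

definition app :: "'v \<Rightarrow> 'v \<Rightarrow> 'v \<Rightarrow> 'v fm" where
  "app f x y = (\<^bold>\<exists>z. is_pair x y z \<^bold>\<and> z \<^bold>\<in> f)"

definition is_fun :: "'v \<Rightarrow> 'v \<Rightarrow> 'v \<Rightarrow> 'v fm" where
  "is_fun f a b =
     ((\<^bold>\<forall>z. z \<^bold>\<in> f \<^bold>\<longrightarrow> (\<^bold>\<exists>x. \<^bold>\<exists>y. x \<^bold>\<in> a \<^bold>\<and> y \<^bold>\<in> b \<^bold>\<and> is_pair x y z))
      \<^bold>\<and> (\<^bold>\<forall>x. x \<^bold>\<in> a \<^bold>\<longrightarrow> (\<^bold>\<exists>y. app f x y \<^bold>\<and> (\<^bold>\<forall>y'. app f x y' \<^bold>\<longrightarrow> y' \<^bold>= y))))"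

definition is_inj :: "'v \<Rightarrow> 'v \<Rightarrow> 'v \<Rightarrow> 'v fm" where
  "is_inj f a b = (is_fun f a b
     \<^bold>\<and> (\<^bold>\<forall>x. \<^bold>\<forall>x'. \<^bold>\<forall>y. app f x y \<^bold>\<and> app f x' y \<^bold>\<longrightarrow> x \<^bold>= x'))"

definition is_bij :: "'v \<Rightarrow> 'v \<Rightarrow> 'v \<Rightarrow> 'v fm" where
  "is_bij f a b = (is_inj f a b \<^bold>\<and> (\<^bold>\<forall>y. y \<^bold>\<in> b \<^bold>\<longrightarrow> (\<^bold>\<exists>x. app f x y)))"

definition is_countable :: "'v \<Rightarrow> 'v fm" where
  "is_countable x = (\<^bold>\<exists>f. \<^bold>\<exists>w. is_omega w \<^bold>\<and> is_inj f x w)"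

definition is_omega1 :: "'v \<Rightarrow> 'v fm" where
  "is_omega1 x = (is_ord x \<^bold>\<and> \<^bold>\<not> is_countable x \<^bold>\<and> (\<^bold>\<forall>y. y \<^bold>\<in> x \<^bold>\<longrightarrow> is_countable y))"


subsection \<open>Axioms\<close>

definition ax_extensionality :: "'v fm" where
  "ax_extensionality = (\<^bold>\<forall>x. \<^bold>\<forall>y. (\<^bold>\<forall>z. z \<^bold>\<in> x \<^bold>\<longleftrightarrow> z \<^bold>\<in> y) \<^bold>\<longrightarrow> x \<^bold>= y)"

definition ax_foundation :: "'v fm" where
  "ax_foundation = (\<^bold>\<forall>x. \<^bold>\<not> is_empty x \<^bold>\<longrightarrow>
     (\<^bold>\<exists>y. y \<^bold>\<in> x \<^bold>\<and> (\<^bold>\<forall>z. z \<^bold>\<in> x \<^bold>\<longrightarrow> \<^bold>\<not> z \<^bold>\<in> y)))"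

definition ax_pairing :: "'v fm" where
  "ax_pairing = (\<^bold>\<forall>x. \<^bold>\<forall>y. \<^bold>\<exists>z. is_upair x y z)"

definition ax_union :: "'v fm" where
  "ax_union = (\<^bold>\<forall>x. \<^bold>\<exists>u. is_union x u)"

definition ax_infinity :: "'v fm" where
  "ax_infinity = (\<^bold>\<exists>x. (\<^bold>\<exists>y. y \<^bold>\<in> x \<^bold>\<and> is_empty y)
     \<^bold>\<and> (\<^bold>\<forall>y. y \<^bold>\<in> x \<^bold>\<longrightarrow> (\<^bold>\<exists>z. z \<^bold>\<in> x \<^bold>\<and> is_succ y z)))"

definition ax_power_set :: "'v fm" where
  "ax_power_set = (\<^bold>\<forall>x. \<^bold>\<exists>y. \<^bold>\<forall>z. z \<^bold>\<in> y \<^bold>\<longleftrightarrow> is_sub z x)"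

definition ax_choice :: "'v fm" where
  "ax_choice = (\<^bold>\<forall>x. (\<^bold>\<forall>y. y \<^bold>\<in> x \<^bold>\<longrightarrow> \<^bold>\<not> is_empty y) \<^bold>\<longrightarrow>
     (\<^bold>\<exists>u. \<^bold>\<exists>f. is_union x u \<^bold>\<and> is_fun f x u \<^bold>\<and> (\<^bold>\<forall>y. \<^bold>\<forall>z. app f y z \<^bold>\<longrightarrow> z \<^bold>\<in> y)))"


subsection \<open>Internal formulas and satisfaction\<close>

text \<open>
  Codes: \<open>\<langle>0, \<langle>i, j\<rangle>\<rangle>\<close> for \<open>v\<^sub>i \<in> v\<^sub>j\<close>, \<open>\<langle>1, \<langle>i, j\<rangle>\<rangle>\<close> for \<open>v\<^sub>i = v\<^sub>j\<close>, \<open>\<langle>2, i\<rangle>\<close> for \<open>P v\<^sub>i\<close>,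
  \<open>\<langle>3, \<phi>\<rangle>\<close> for negation, \<open>\<langle>4, \<langle>\<phi>, \<psi>\<rangle>\<rangle>\<close> for conjunction, \<open>\<langle>5, \<langle>i, \<phi>\<rangle>\<rangle>\<close> for universal
  quantification over \<open>v\<^sub>i\<close>.
\<close>

definition tagged :: "nat \<Rightarrow> 'v \<Rightarrow> 'v \<Rightarrow> 'v fm" where
  "tagged k t z = (\<^bold>\<exists>n. is_num k n \<^bold>\<and> is_pair n t z)"

definition tagged2 :: "nat \<Rightarrow> 'v \<Rightarrow> 'v \<Rightarrow> 'v \<Rightarrow> 'v fm" where
  "tagged2 k s t z = (\<^bold>\<exists>q. is_pair s t q \<^bold>\<and> tagged k q z)"

definition closed_ST :: "'v \<Rightarrow> 'v fm" where
  "closed_ST X = (\<^bold>\<forall>w. is_omega w \<^bold>\<longrightarrow>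
     (\<^bold>\<forall>i. \<^bold>\<forall>j. \<^bold>\<forall>z. i \<^bold>\<in> w \<^bold>\<and> j \<^bold>\<in> w \<^bold>\<and> (tagged2 0 i j z \<^bold>\<or> tagged2 1 i j z) \<^bold>\<longrightarrow> z \<^bold>\<in> X)
     \<^bold>\<and> (\<^bold>\<forall>\<phi>. \<^bold>\<forall>z. \<phi> \<^bold>\<in> X \<^bold>\<and> tagged 3 \<phi> z \<^bold>\<longrightarrow> z \<^bold>\<in> X)
     \<^bold>\<and> (\<^bold>\<forall>\<phi>. \<^bold>\<forall>\<psi>. \<^bold>\<forall>z. \<phi> \<^bold>\<in> X \<^bold>\<and> \<psi> \<^bold>\<in> X \<^bold>\<and> tagged2 4 \<phi> \<psi> z \<^bold>\<longrightarrow> z \<^bold>\<in> X)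
     \<^bold>\<and> (\<^bold>\<forall>i. \<^bold>\<forall>\<phi>. \<^bold>\<forall>z. i \<^bold>\<in> w \<^bold>\<and> \<phi> \<^bold>\<in> X \<^bold>\<and> tagged2 5 i \<phi> z \<^bold>\<longrightarrow> z \<^bold>\<in> X))"

definition closed_STP :: "'v \<Rightarrow> 'v fm" where
  "closed_STP X = (closed_ST X
     \<^bold>\<and> (\<^bold>\<forall>w. is_omega w \<^bold>\<longrightarrow> (\<^bold>\<forall>i. \<^bold>\<forall>z. i \<^bold>\<in> w \<^bold>\<and> tagged 2 i z \<^bold>\<longrightarrow> z \<^bold>\<in> X)))"

definition fml_ST :: "'v \<Rightarrow> 'v fm" where
  "fml_ST \<phi> = (\<^bold>\<forall>X. closed_ST X \<^bold>\<longrightarrow> \<phi> \<^bold>\<in> X)"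

definition fml_STP :: "'v \<Rightarrow> 'v fm" where
  "fml_STP \<phi> = (\<^bold>\<forall>X. closed_STP X \<^bold>\<longrightarrow> \<phi> \<^bold>\<in> X)"

text \<open>An assignment in \<open>U\<close> is a function from \<open>\<omega>\<close> to \<open>U\<close>; \<open>is_upd s i x s'\<close> says that \<open>s'\<close> is
  \<open>s\<close> with its value at \<open>i\<close> changed to \<open>x\<close>.\<close>

definition is_asg :: "'v \<Rightarrow> 'v \<Rightarrow> 'v fm" where
  "is_asg U s = (\<^bold>\<exists>w. is_omega w \<^bold>\<and> is_fun s w U)"

definition is_upd :: "'v \<Rightarrow> 'v \<Rightarrow> 'v \<Rightarrow> 'v \<Rightarrow> 'v \<Rightarrow> 'v fm" where
  "is_upd U s i x s' = (is_asg U s' \<^bold>\<and> app s' i x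
     \<^bold>\<and> (\<^bold>\<forall>j. \<^bold>\<forall>y. \<^bold>\<not> j \<^bold>= i \<^bold>\<longrightarrow> (app s' j y \<^bold>\<longleftrightarrow> app s j y)))"

text \<open>\<open>is_sat U Q S\<close>: \<open>S\<close> obeys the Tarski clauses for satisfaction in the structure with universe
  \<open>U\<close>, the true membership relation, and \<open>Q\<close> as the interpretation of the predicate symbol;
  \<open>app S \<phi> s\<close> reads ``\<open>s\<close> satisfies \<open>\<phi>\<close>''.\<close>

definition is_sat :: "'v \<Rightarrow> 'v \<Rightarrow> 'v \<Rightarrow> 'v fm" where
  "is_sat U Q S = (\<^bold>\<forall>w. \<^bold>\<forall>s. is_omega w \<^bold>\<and> is_asg U s \<^bold>\<longrightarrow>
     (\<^bold>\<forall>i. \<^bold>\<forall>j. \<^bold>\<forall>z. i \<^bold>\<in> w \<^bold>\<and> j \<^bold>\<in> w \<^bold>\<and> tagged2 0 i j z \<^bold>\<longrightarrow>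
        (app S z s \<^bold>\<longleftrightarrow> (\<^bold>\<exists>x. \<^bold>\<exists>y. app s i x \<^bold>\<and> app s j y \<^bold>\<and> x \<^bold>\<in> y)))
     \<^bold>\<and> (\<^bold>\<forall>i. \<^bold>\<forall>j. \<^bold>\<forall>z. i \<^bold>\<in> w \<^bold>\<and> j \<^bold>\<in> w \<^bold>\<and> tagged2 1 i j z \<^bold>\<longrightarrow>
        (app S z s \<^bold>\<longleftrightarrow> (\<^bold>\<exists>x. app s i x \<^bold>\<and> app s j x)))
     \<^bold>\<and> (\<^bold>\<forall>i. \<^bold>\<forall>z. i \<^bold>\<in> w \<^bold>\<and> tagged 2 i z \<^bold>\<longrightarrow>
        (app S z s \<^bold>\<longleftrightarrow> (\<^bold>\<exists>x. app s i x \<^bold>\<and> x \<^bold>\<in> Q)))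
     \<^bold>\<and> (\<^bold>\<forall>\<phi>. \<^bold>\<forall>z. fml_STP \<phi> \<^bold>\<and> tagged 3 \<phi> z \<^bold>\<longrightarrow>
        (app S z s \<^bold>\<longleftrightarrow> \<^bold>\<not> app S \<phi> s))
     \<^bold>\<and> (\<^bold>\<forall>\<phi>. \<^bold>\<forall>\<psi>. \<^bold>\<forall>z. fml_STP \<phi> \<^bold>\<and> fml_STP \<psi> \<^bold>\<and> tagged2 4 \<phi> \<psi> z \<^bold>\<longrightarrow>
        (app S z s \<^bold>\<longleftrightarrow> app S \<phi> s \<^bold>\<and> app S \<psi> s))
     \<^bold>\<and> (\<^bold>\<forall>i. \<^bold>\<forall>\<phi>. \<^bold>\<forall>z. i \<^bold>\<in> w \<^bold>\<and> fml_STP \<phi> \<^bold>\<and> tagged2 5 i \<phi> z \<^bold>\<longrightarrow>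
        (app S z s \<^bold>\<longleftrightarrow> (\<^bold>\<forall>x. \<^bold>\<forall>s'. x \<^bold>\<in> U \<^bold>\<and> is_upd U s i x s' \<^bold>\<longrightarrow> app S \<phi> s'))))"

definition models :: "'v \<Rightarrow> 'v \<Rightarrow> 'v \<Rightarrow> 'v \<Rightarrow> 'v fm" where
  "models U Q \<phi> s = (\<^bold>\<exists>S. is_sat U Q S \<^bold>\<and> app S \<phi> s)"

definition elem_emb :: "'v \<Rightarrow> 'v \<Rightarrow> 'v \<Rightarrow> 'v \<Rightarrow> 'v \<Rightarrow> 'v fm" where
  "elem_emb \<sigma> U Q U' Q' = (is_fun \<sigma> U U' \<^bold>\<and>
     (\<^bold>\<forall>\<phi>. \<^bold>\<forall>s. \<^bold>\<forall>s'. fml_STP \<phi> \<^bold>\<and> is_asg U s \<^bold>\<and> is_asg U' s'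
        \<^bold>\<and> (\<^bold>\<forall>i. \<^bold>\<forall>x. app s i x \<^bold>\<longrightarrow> (\<^bold>\<exists>y. app \<sigma> x y \<^bold>\<and> app s' i y))
        \<^bold>\<longrightarrow> (models U Q \<phi> s \<^bold>\<longleftrightarrow> models U' Q' \<phi> s')))"

text \<open>\<open>y\<close> belongs to the hull of \<open>X\<close> (given as a formula in one variable, defining a nonempty
  subclass of \<open>U\<close>) if some \<open>\<phi>\<close> together with values in \<open>X\<close> for all variables other than \<open>v\<^sub>0\<close>
  defines \<open>y\<close>, as the unique value of \<open>v\<^sub>0\<close> making \<open>\<phi>\<close> true.\<close>

definition in_hull :: "'v \<Rightarrow> 'v \<Rightarrow> ('v \<Rightarrow> 'v fm) \<Rightarrow> 'v \<Rightarrow> 'v fm" where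
  "in_hull U Q X y = (\<^bold>\<exists>\<phi>. \<^bold>\<exists>s. \<^bold>\<exists>n. is_num 0 n \<^bold>\<and> fml_STP \<phi> \<^bold>\<and> is_asg U s \<^bold>\<and> app s n y
     \<^bold>\<and> (\<^bold>\<forall>i. \<^bold>\<forall>x. app s i x \<^bold>\<and> \<^bold>\<not> i \<^bold>= n \<^bold>\<longrightarrow> X x)
     \<^bold>\<and> models U Q \<phi> s
     \<^bold>\<and> (\<^bold>\<forall>x. \<^bold>\<forall>s'. is_upd U s n x s' \<^bold>\<and> models U Q \<phi> s' \<^bold>\<longrightarrow> x \<^bold>= y))"


section \<open>Inside a universe of sets\<close>

text \<open>Truth of a formula relativized to the class \<open>C\<close>.\<close>

primrec holds_in :: "('v \<Rightarrow> 'v \<Rightarrow> bool) \<Rightarrow> ('v \<Rightarrow> bool) \<Rightarrow> 'v fm \<Rightarrow> bool" where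
  "holds_in E C (x \<^bold>\<in> y) \<longleftrightarrow> E x y"
| "holds_in E C (x \<^bold>= y) \<longleftrightarrow> x = y"
| "holds_in E C (\<^bold>\<not> \<phi>) \<longleftrightarrow> \<not> holds_in E C \<phi>"
| "holds_in E C (\<phi> \<^bold>\<and> \<psi>) \<longleftrightarrow> holds_in E C \<phi> \<and> holds_in E C \<psi>"
| "holds_in E C (All F) \<longleftrightarrow> (\<forall>x. C x \<longrightarrow> holds_in E C (F x))"

locale set_universe =
  fixes mem :: "'v \<Rightarrow> 'v \<Rightarrow> bool" (infix "\<epsilon>" 50)
begin

abbreviation holds :: "'v fm \<Rightarrow> bool" ("\<Turnstile> _" [20] 20) where
  "\<Turnstile> \<phi> \<equiv> holds_in mem (\<lambda>_. True) \<phi>"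

abbreviation holds_in_set :: "'v \<Rightarrow> 'v fm \<Rightarrow> bool" where
  "holds_in_set U \<phi> \<equiv> holds_in mem (\<lambda>x. x \<epsilon> U) \<phi>"


subsection \<open>ZFC and its fragments\<close>

definition separation_for :: "('v \<Rightarrow> bool) \<Rightarrow> ('v \<Rightarrow> bool) \<Rightarrow> bool" where
  "separation_for C \<Phi> \<longleftrightarrow>
     (\<forall>a. C a \<longrightarrow> (\<exists>y. C y \<and> (\<forall>x. C x \<longrightarrow> (x \<epsilon> y \<longleftrightarrow> x \<epsilon> a \<and> \<Phi> x))))"

definition replacement_for :: "('v \<Rightarrow> bool) \<Rightarrow> ('v \<Rightarrow> 'v \<Rightarrow> bool) \<Rightarrow> bool" where
  "replacement_for C \<Phi> \<longleftrightarrow>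
     (\<forall>a. C a \<and> (\<forall>x. C x \<and> x \<epsilon> a \<longrightarrow> (\<exists>!y. C y \<and> \<Phi> x y)) \<longrightarrow>
        (\<exists>b. C b \<and> (\<forall>y. C y \<longrightarrow> (y \<epsilon> b \<longleftrightarrow> (\<exists>x. C x \<and> x \<epsilon> a \<and> \<Phi> x y)))))"

definition finite_axioms :: "('v \<Rightarrow> bool) \<Rightarrow> bool" where
  "finite_axioms C \<longleftrightarrow>
     holds_in mem C ax_extensionality \<and> holds_in mem C ax_foundation
     \<and> holds_in mem C ax_pairing \<and> holds_in mem C ax_union \<and> holds_in mem C ax_infinity"

definition ZFC :: bool where
  "ZFC \<longleftrightarrow> finite_axioms (\<lambda>_. True) \<and> (\<Turnstile> ax_power_set) \<and> (\<Turnstile> ax_choice)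
     \<and> (\<forall>\<phi> e. separation_for (\<lambda>_. True) (\<lambda>x. \<Turnstile> inst \<phi> (e(0 := x))))
     \<and> (\<forall>\<phi> e. replacement_for (\<lambda>_. True) (\<lambda>x y. \<Turnstile> inst \<phi> (e(0 := x, 1 := y))))"

text \<open>Truth in the set structure \<open>(U, \<in>, Q)\<close> of the internal formula \<open>\<phi>\<close> under the assignment
  \<open>s\<close> with \<open>v\<^sub>0\<close> (and \<open>v\<^sub>1\<close>) reassigned.\<close>

definition models1 :: "'v \<Rightarrow> 'v \<Rightarrow> 'v \<Rightarrow> 'v \<Rightarrow> 'v \<Rightarrow> bool" where
  "models1 U Q \<phi> s x \<longleftrightarrow>
     (\<exists>i s'. (\<Turnstile> is_num 0 i) \<and> (\<Turnstile> is_upd U s i x s') \<and> (\<Turnstile> models U Q \<phi> s'))"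

definition models2 :: "'v \<Rightarrow> 'v \<Rightarrow> 'v \<Rightarrow> 'v \<Rightarrow> 'v \<Rightarrow> 'v \<Rightarrow> bool" where
  "models2 U Q \<phi> s x y \<longleftrightarrow>
     (\<exists>i s'. (\<Turnstile> is_num 1 i) \<and> (\<Turnstile> is_upd U s i y s') \<and> models1 U Q \<phi> s' x)"

definition zf_minus_wrt :: "('v \<Rightarrow> 'v fm) \<Rightarrow> 'v \<Rightarrow> 'v \<Rightarrow> bool" where
  "zf_minus_wrt fml U Q \<longleftrightarrow> finite_axioms (\<lambda>x. x \<epsilon> U)
     \<and> (\<forall>\<phi> s. (\<Turnstile> fml \<phi>) \<and> (\<Turnstile> is_asg U s) \<longrightarrow>
          separation_for (\<lambda>x. x \<epsilon> U) (models1 U Q \<phi> s)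
          \<and> replacement_for (\<lambda>x. x \<epsilon> U) (models2 U Q \<phi> s))"

text \<open>An \<open>\<L>\<^sub>S\<^sub>T\<close>-structure is given by its universe \<open>U\<close>, an \<open>\<L>\<^sub>S\<^sub>T\<^sup>+\<close>-structure by \<open>U\<close> and the
  interpretation \<open>Q\<close> of the predicate. \<open>\<L>\<^sub>S\<^sub>T\<close>-formulas do not mention the predicate, so the third
  argument \<open>U\<close> in the first definition is a dummy.\<close>

definition ZF_minus_ST :: "'v \<Rightarrow> bool" where
  "ZF_minus_ST U \<longleftrightarrow> zf_minus_wrt fml_ST U U"

definition ZFC_minus_ST :: "'v \<Rightarrow> bool" where
  "ZFC_minus_ST U \<longleftrightarrow> ZF_minus_ST U \<and> holds_in_set U ax_choice"

definition ZFC_minus_STP :: "'v \<Rightarrow> 'v \<Rightarrow> bool" where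
  "ZFC_minus_STP U Q \<longleftrightarrow> (\<Turnstile> is_sub Q U) \<and> zf_minus_wrt fml_STP U Q \<and> holds_in_set U ax_choice"


subsection \<open>Sets in the universe\<close>

definition opair :: "'v \<Rightarrow> 'v \<Rightarrow> 'v" where
  "opair a b = (THE z. \<Turnstile> is_pair a b z)"

definition triple :: "'v \<Rightarrow> 'v \<Rightarrow> 'v \<Rightarrow> 'v" where
  "triple a b c = opair a (opair b c)"

definition setof :: "('v \<Rightarrow> bool) \<Rightarrow> 'v" where
  "setof \<Phi> = (THE z. \<forall>x. x \<epsilon> z \<longleftrightarrow> \<Phi> x)"

definition omega1 :: 'v where
  "omega1 = (THE x. \<Turnstile> is_omega1 x)"

definition regular :: "'v \<Rightarrow> bool" where
  "regular \<theta> \<longleftrightarrow> (\<Turnstile> is_ord \<theta>) \<and> (\<exists>w. (\<Turnstile> is_omega w) \<and> (\<Turnstile> is_sub w \<theta>))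
     \<and> (\<forall>\<alpha> f. \<alpha> \<epsilon> \<theta> \<and> (\<Turnstile> is_fun f \<alpha> \<theta>) \<longrightarrow>
          (\<exists>\<beta>. \<beta> \<epsilon> \<theta> \<and> (\<forall>\<gamma> \<delta>. (\<Turnstile> app f \<gamma> \<delta>) \<longrightarrow> \<delta> \<epsilon> \<beta>)))"

definition trans_closure :: "'v \<Rightarrow> 'v \<Rightarrow> bool" where
  "trans_closure x T \<longleftrightarrow> (\<Turnstile> is_trans T) \<and> (\<Turnstile> is_sub x T)
     \<and> (\<forall>T'. (\<Turnstile> is_trans T') \<and> (\<Turnstile> is_sub x T') \<longrightarrow> (\<Turnstile> is_sub T T'))"

text \<open>\<open>x \<in> H\<^sub>\<theta>\<close> for a cardinal \<open>\<theta>\<close>.\<close>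

definition in_H :: "'v \<Rightarrow> 'v \<Rightarrow> bool" where
  "in_H \<theta> x \<longleftrightarrow> (\<exists>T \<alpha> f. trans_closure x T \<and> \<alpha> \<epsilon> \<theta> \<and> (\<Turnstile> is_inj f T \<alpha>))"

text \<open>\<open>d\<close> is a subset of \<open>U\<close> definable with parameters over \<open>(U, \<in>, Q)\<close>. The disjunct for the
  empty set matters only for \<open>U = \<emptyset>\<close>, where there are no assignments.\<close>

definition in_Def :: "'v \<Rightarrow> 'v \<Rightarrow> 'v \<Rightarrow> bool" where
  "in_Def U Q d \<longleftrightarrow> (\<Turnstile> is_empty d)
     \<or> (\<exists>\<phi> s. (\<Turnstile> fml_STP \<phi>) \<and> (\<Turnstile> is_asg U s)
          \<and> (\<forall>x. x \<epsilon> d \<longleftrightarrow> x \<epsilon> U \<and> models1 U Q \<phi> s x))"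

definition intersection :: "'v \<Rightarrow> 'v \<Rightarrow> 'v" where
  "intersection A B = setof (\<lambda>x. x \<epsilon> A \<and> x \<epsilon> B)"

text \<open>The hierarchy \<open>L\<^sub>\<alpha>[A] = \<Union>\<^bsub>\<beta><\<alpha>\<^esub> Def(L\<^sub>\<beta>[A], \<in>, A \<intersection> L\<^sub>\<beta>[A])\<close>, witnessed by a function \<open>F\<close> on
  \<open>\<chi> + 1\<close>.\<close>

definition is_Lev :: "'v \<Rightarrow> 'v \<Rightarrow> 'v \<Rightarrow> bool" where
  "is_Lev A \<chi> l \<longleftrightarrow> (\<exists>F D B. (\<Turnstile> is_succ \<chi> D) \<and> (\<Turnstile> is_fun F D B) \<and> (\<Turnstile> app F \<chi> l)
     \<and> (\<forall>\<alpha> u. (\<Turnstile> app F \<alpha> u) \<longrightarrow>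
          (\<forall>d. d \<epsilon> u \<longleftrightarrow> (\<exists>\<beta> v. \<beta> \<epsilon> \<alpha> \<and> (\<Turnstile> app F \<beta> v) \<and> in_Def v (intersection A v) d))))"

definition Lev :: "'v \<Rightarrow> 'v \<Rightarrow> 'v" where
  "Lev A \<chi> = (THE l. is_Lev A \<chi> l)"


subsection \<open>Forcing notions\<close>

text \<open>A forcing notion is a triple \<open>\<langle>carrier, order, largest element\<rangle>\<close>.\<close>

definition carrier :: "'v \<Rightarrow> 'v" where
  "carrier P = (THE C. \<exists>R i. P = triple C R i)"

definition order_of :: "'v \<Rightarrow> 'v" where
  "order_of P = (THE R. \<exists>C i. P = triple C R i)"

definition one_of :: "'v \<Rightarrow> 'v" where
  "one_of P = (THE i. \<exists>C R. P = triple C R i)"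

definition le :: "'v \<Rightarrow> 'v \<Rightarrow> 'v \<Rightarrow> bool" where
  "le P q p \<longleftrightarrow> (\<Turnstile> app (order_of P) q p)"

definition compatible :: "'v \<Rightarrow> 'v \<Rightarrow> 'v \<Rightarrow> bool" where
  "compatible P p q \<longleftrightarrow> (\<exists>r. r \<epsilon> carrier P \<and> le P r p \<and> le P r q)"

definition forcing_notion :: "'v \<Rightarrow> bool" where
  "forcing_notion P \<longleftrightarrow> P = triple (carrier P) (order_of P) (one_of P)
     \<and> (\<forall>z. z \<epsilon> order_of P \<longrightarrow> (\<exists>p q. p \<epsilon> carrier P \<and> q \<epsilon> carrier P \<and> z = opair p q))
     \<and> (\<forall>p. p \<epsilon> carrier P \<longrightarrow> le P p p)
     \<and> (\<forall>p q r. le P p q \<and> le P q r \<longrightarrow> le P p r)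
     \<and> one_of P \<epsilon> carrier P \<and> (\<forall>p. p \<epsilon> carrier P \<longrightarrow> le P p (one_of P))
     \<and> (\<forall>p q. p \<epsilon> carrier P \<and> q \<epsilon> carrier P \<and> \<not> le P p q \<longrightarrow>
          (\<exists>r. r \<epsilon> carrier P \<and> le P r p \<and> \<not> compatible P r q))"

definition dense :: "'v \<Rightarrow> 'v \<Rightarrow> bool" where
  "dense P D \<longleftrightarrow> (\<Turnstile> is_sub D (carrier P))
     \<and> (\<forall>p. p \<epsilon> carrier P \<longrightarrow> (\<exists>d. d \<epsilon> D \<and> le P d p))"

definition filter_on :: "'v \<Rightarrow> 'v \<Rightarrow> bool" where
  "filter_on P g \<longleftrightarrow> (\<Turnstile> is_sub g (carrier P)) \<and> (\<exists>p. p \<epsilon> g)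
     \<and> (\<forall>p q. p \<epsilon> g \<and> q \<epsilon> carrier P \<and> le P p q \<longrightarrow> q \<epsilon> g)
     \<and> (\<forall>p q. p \<epsilon> g \<and> q \<epsilon> g \<longrightarrow> (\<exists>r. r \<epsilon> g \<and> le P r p \<and> le P r q))"

definition generic_over :: "'v \<Rightarrow> 'v \<Rightarrow> 'v \<Rightarrow> bool" where
  "generic_over U P G \<longleftrightarrow> filter_on P G
     \<and> (\<forall>D. D \<epsilon> U \<and> dense P D \<longrightarrow> (\<exists>p. p \<epsilon> G \<and> p \<epsilon> D))"

text \<open>The least cardinality of a dense subset.\<close>

definition dense_size :: "'v \<Rightarrow> 'v \<Rightarrow> bool" where
  "dense_size P \<kappa> \<longleftrightarrow> (\<Turnstile> is_ord \<kappa>) \<and> (\<exists>D f. dense P D \<and> (\<Turnstile> is_bij f D \<kappa>))"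

definition density :: "'v \<Rightarrow> 'v" where
  "density P = (THE \<kappa>. dense_size P \<kappa> \<and> (\<forall>\<mu>. dense_size P \<mu> \<longrightarrow> (\<Turnstile> is_sub \<kappa> \<mu>)))"


subsection \<open>Names and the forcing relation\<close>

definition is_name :: "'v \<Rightarrow> 'v \<Rightarrow> bool" where
  "is_name P \<tau> \<longleftrightarrow> (\<exists>T. \<tau> \<epsilon> T \<and> (\<forall>\<rho> z. \<rho> \<epsilon> T \<and> z \<epsilon> \<rho> \<longrightarrow>
     (\<exists>\<pi> p. z = opair \<pi> p \<and> \<pi> \<epsilon> T \<and> p \<epsilon> carrier P)))"

text \<open>\<open>x\<^sup>\<or> = {\<langle>y\<^sup>\<or>, 1\<rangle> | y \<in> x}\<close>, by recursion along a transitive set \<open>T\<close>.\<close>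

definition is_check :: "'v \<Rightarrow> 'v \<Rightarrow> 'v \<Rightarrow> bool" where
  "is_check P x c \<longleftrightarrow> (\<exists>T F B. (\<Turnstile> is_trans T) \<and> x \<epsilon> T \<and> (\<Turnstile> is_fun F T B) \<and> (\<Turnstile> app F x c)
     \<and> (\<forall>y d. (\<Turnstile> app F y d) \<longrightarrow>
          (\<forall>z. z \<epsilon> d \<longleftrightarrow> (\<exists>u v. u \<epsilon> y \<and> (\<Turnstile> app F u v) \<and> z = opair v (one_of P)))))"

definition check :: "'v \<Rightarrow> 'v \<Rightarrow> 'v" where
  "check P x = (THE c. is_check P x c)"

definition generic_name :: "'v \<Rightarrow> 'v" where
  "generic_name P = setof (\<lambda>z. \<exists>p. p \<epsilon> carrier P \<and> z = opair (check P p) p)"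

text \<open>
  The forcing relation for atomic formulas is defined by the usual simultaneous recursion on
  names, carried out on a set \<open>T\<close> of names containing with each name \<open>\<tau>\<close> all names in
  \<open>dom(\<tau>)\<close>. The sets \<open>FE\<close> and \<open>FM\<close> collect the triples \<open>\<langle>p, a, b\<rangle>\<close> with \<open>p\<close> forcing
  \<open>a = b\<close> and \<open>a \<in> b\<close>, respectively.
\<close>

definition forcing_table :: "'v \<Rightarrow> 'v \<Rightarrow> 'v \<Rightarrow> 'v \<Rightarrow> bool" where
  "forcing_table P T FE FM \<longleftrightarrow>
     (\<forall>a c r. a \<epsilon> T \<and> (\<Turnstile> app a c r) \<longrightarrow> c \<epsilon> T)
     \<and> (\<forall>p a b. p \<epsilon> carrier P \<and> a \<epsilon> T \<and> b \<epsilon> T \<longrightarrow>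
          (triple p a b \<epsilon> FE \<longleftrightarrow>
             (\<forall>c q. (\<exists>r. (\<Turnstile> app a c r) \<or> (\<Turnstile> app b c r)) \<and> q \<epsilon> carrier P \<and> le P q p \<longrightarrow>
                (triple q c a \<epsilon> FM \<longleftrightarrow> triple q c b \<epsilon> FM)))
        \<and> (triple p a b \<epsilon> FM \<longleftrightarrow>
             (\<forall>q. q \<epsilon> carrier P \<and> le P q p \<longrightarrow>
                (\<exists>q' c r. q' \<epsilon> carrier P \<and> le P q' q \<and> (\<Turnstile> app b c r) \<and> le P q' r
                   \<and> triple q' a c \<epsilon> FE))))"

definition forces_eq :: "'v \<Rightarrow> 'v \<Rightarrow> 'v \<Rightarrow> 'v \<Rightarrow> bool" where
  "forces_eq P p a b \<longleftrightarrow>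
     (\<exists>T FE FM. forcing_table P T FE FM \<and> a \<epsilon> T \<and> b \<epsilon> T \<and> triple p a b \<epsilon> FE)"

definition forces_mem :: "'v \<Rightarrow> 'v \<Rightarrow> 'v \<Rightarrow> 'v \<Rightarrow> bool" where
  "forces_mem P p a b \<longleftrightarrow>
     (\<exists>T FE FM. forcing_table P T FE FM \<and> a \<epsilon> T \<and> b \<epsilon> T \<and> triple p a b \<epsilon> FM)"

text \<open>\<open>forces P \<phi> p\<close>: the condition \<open>p\<close> forces \<open>\<phi>\<close>, whose parameters are \<open>P\<close>-names.\<close>

primrec forces :: "'v \<Rightarrow> 'v fm \<Rightarrow> 'v \<Rightarrow> bool" where
  "forces P (a \<^bold>\<in> b) = (\<lambda>p. forces_mem P p a b)"
| "forces P (a \<^bold>= b) = (\<lambda>p. forces_eq P p a b)"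
| "forces P (\<^bold>\<not> \<phi>) = (\<lambda>p. \<forall>q. q \<epsilon> carrier P \<and> le P q p \<longrightarrow> \<not> forces P \<phi> q)"
| "forces P (\<phi> \<^bold>\<and> \<psi>) = (\<lambda>p. forces P \<phi> p \<and> forces P \<psi> p)"
| "forces P (All F) = (\<lambda>p. \<forall>\<tau>. is_name P \<tau> \<longrightarrow> forces P (F \<tau>) p)"


subsection \<open>Full models and model sequences\<close>

text \<open>The structure \<open>(U, \<in>, Q)\<close>, as an element of other models, is the pair \<open>\<langle>U, Q\<rangle>\<close>.\<close>

definition full_model :: "'v \<Rightarrow> 'v \<Rightarrow> bool" where
  "full_model U Q \<longleftrightarrow> (\<Turnstile> is_trans U) \<and> ZFC_minus_STP U Q
     \<and> (\<exists>N. (\<Turnstile> is_trans N) \<and> ZF_minus_ST N \<and> opair U Q \<epsilon> N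
          \<and> (\<forall>x f. x \<epsilon> U \<and> f \<epsilon> N \<and> (\<Turnstile> is_fun f x U) \<longrightarrow> f \<epsilon> U))"

definition club :: "'v \<Rightarrow> bool" where
  "club C \<longleftrightarrow> (\<Turnstile> is_sub C omega1)
     \<and> (\<forall>\<alpha>. \<alpha> \<epsilon> omega1 \<longrightarrow> (\<exists>\<beta>. \<beta> \<epsilon> C \<and> \<alpha> \<epsilon> \<beta>))
     \<and> (\<forall>\<delta>. \<delta> \<epsilon> omega1 \<and> (\<exists>\<alpha>. \<alpha> \<epsilon> \<delta>)
          \<and> (\<forall>\<alpha>. \<alpha> \<epsilon> \<delta> \<longrightarrow> (\<exists>\<beta>. \<beta> \<epsilon> C \<and> \<beta> \<epsilon> \<delta> \<and> \<alpha> \<epsilon> \<beta>)) \<longrightarrow> \<delta> \<epsilon> C)"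

definition stationarily_many :: "('v \<Rightarrow> bool) \<Rightarrow> bool" where
  "stationarily_many S \<longleftrightarrow> (\<forall>C. club C \<longrightarrow> (\<exists>\<xi>. \<xi> \<epsilon> C \<and> S \<xi>))"

definition adequate :: "'v \<Rightarrow> bool" where
  "adequate K \<longleftrightarrow> (\<exists>B. \<Turnstile> is_fun K omega1 B)
     \<and> (\<forall>\<xi> k. (\<Turnstile> app K \<xi> k) \<longrightarrow>
          (\<Turnstile> is_trans k) \<and> ZFC_minus_ST k \<and> \<xi> \<epsilon> k \<and> holds_in_set k (is_countable \<xi>))
     \<and> (\<forall>B. (\<Turnstile> is_sub B omega1) \<longrightarrow>
          stationarily_many (\<lambda>\<xi>. \<exists>k. (\<Turnstile> app K \<xi> k) \<and> intersection B \<xi> \<epsilon> k))"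

text \<open>\<open>K_at K U k\<close>: \<open>\<omega>\<^sub>1\<close> in the sense of \<open>U\<close> exists, and \<open>k\<close> is the member of the sequence \<open>K\<close>
  with that index.\<close>

definition K_at :: "'v \<Rightarrow> 'v \<Rightarrow> 'v \<Rightarrow> bool" where
  "K_at K U k \<longleftrightarrow> (\<exists>\<alpha>. \<alpha> \<epsilon> U \<and> holds_in_set U (is_omega1 \<alpha>) \<and> (\<Turnstile> app K \<alpha> k))"

definition K_good :: "'v \<Rightarrow> 'v \<Rightarrow> 'v \<Rightarrow> bool" where
  "K_good K U Q \<longleftrightarrow> full_model U Q
     \<and> (\<exists>k. K_at K U k \<and> opair U Q \<epsilon> k \<and> holds_in_set k (is_countable U))"


subsection \<open>Subcompleteness\<close>

text \<open>The conditions common to both notions of subcompleteness on \<open>A\<close>, \<open>\<chi>\<close>, the countable model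
  \<open>(U, Q)\<close>, and \<open>\<sigma>\<close>; \<open>M = L\<^sub>\<chi>[A]\<close> with predicate \<open>A \<intersection> M\<close>.\<close>

definition embedding_setup ::
  "'v \<Rightarrow> 'v \<Rightarrow> 'v \<Rightarrow> 'v \<Rightarrow> 'v \<Rightarrow> 'v \<Rightarrow> 'v \<Rightarrow> 'v \<Rightarrow> 'v \<Rightarrow> 'v \<Rightarrow> 'v \<Rightarrow> bool" where
  "embedding_setup P \<theta> a A \<chi> U Q P' b' \<sigma> b \<longleftrightarrow>
     (let M = Lev A \<chi> in
       (\<Turnstile> is_ord \<chi>) \<and> (\<forall>x. in_H \<theta> x \<longrightarrow> x \<epsilon> M) \<and> ZFC_minus_STP M (intersection A M)
       \<and> P' \<epsilon> U \<and> b' \<epsilon> U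
       \<and> (\<Turnstile> elem_emb \<sigma> U Q M (intersection A M)) \<and> (\<exists>x. \<Turnstile> app \<sigma> x a)
       \<and> (\<Turnstile> app \<sigma> (opair P' b') (opair P b)))"

text \<open>The formula in the forcing language saying that \<open>\<sigma>* : (U, Q) \<prec> (M, Q')\<close> with
  \<open>\<sigma>*(x) = y\<close> and \<open>\<sigma>*[G'] \<subseteq> G\<close>; all arguments are names.\<close>

definition lifts :: "'v \<Rightarrow> 'v \<Rightarrow> 'v \<Rightarrow> 'v \<Rightarrow> 'v \<Rightarrow> 'v \<Rightarrow> 'v \<Rightarrow> 'v \<Rightarrow> 'v \<Rightarrow> 'v fm" where
  "lifts U Q M Q' x y G' G \<sigma>' =
     (elem_emb \<sigma>' U Q M Q' \<^bold>\<and> app \<sigma>' x y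
      \<^bold>\<and> (\<^bold>\<forall>u. \<^bold>\<forall>v. u \<^bold>\<in> G' \<^bold>\<and> app \<sigma>' u v \<^bold>\<longrightarrow> v \<^bold>\<in> G))"

definition same_hull :: "'v \<Rightarrow> 'v \<Rightarrow> 'v \<Rightarrow> 'v \<Rightarrow> 'v \<Rightarrow> 'v fm" where
  "same_hull M Q' \<delta> \<sigma> \<sigma>' =
     (\<^bold>\<forall>y. in_hull M Q' (\<lambda>x. x \<^bold>\<in> \<delta> \<^bold>\<or> (\<^bold>\<exists>u. app \<sigma>' u x)) y
        \<^bold>\<longleftrightarrow> in_hull M Q' (\<lambda>x. x \<^bold>\<in> \<delta> \<^bold>\<or> (\<^bold>\<exists>u. app \<sigma> u x)) y)"

definition verifies_K_subcomplete :: "'v \<Rightarrow> 'v \<Rightarrow> 'v \<Rightarrow> 'v \<Rightarrow> bool" where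
  "verifies_K_subcomplete K P \<theta> a \<longleftrightarrow> regular \<theta> \<and> in_H \<theta> a \<and> in_H \<theta> P
     \<and> (\<forall>A \<chi> U Q P' b' \<sigma> b G'.
          K_good K U Q \<and> embedding_setup P \<theta> a A \<chi> U Q P' b' \<sigma> b
          \<and> generic_over U P' G' \<and> (\<exists>k. K_at K U k \<and> G' \<epsilon> k) \<longrightarrow>
          (let M = Lev A \<chi>; c = check P in
            \<exists>p. p \<epsilon> carrier P \<and>
              forces P
                (\<^bold>\<exists>\<sigma>'. lifts (c U) (c Q) (c M) (c (intersection A M))
                        (c (opair P' b')) (c (opair P b)) (c G') (generic_name P) \<sigma>') p))"

definition K_subcomplete :: "'v \<Rightarrow> 'v \<Rightarrow> bool" where
  "K_subcomplete K P \<longleftrightarrow> (\<exists>\<theta> a. verifies_K_subcomplete K P \<theta> a)"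

definition verifies_subcomplete :: "'v \<Rightarrow> 'v \<Rightarrow> 'v \<Rightarrow> bool" where
  "verifies_subcomplete P \<theta> a \<longleftrightarrow> regular \<theta> \<and> in_H \<theta> a \<and> in_H \<theta> P
     \<and> (\<forall>A \<chi> U Q P' b' \<sigma> b G'.
          full_model U Q \<and> (\<Turnstile> is_countable U)
          \<and> embedding_setup P \<theta> a A \<chi> U Q P' b' \<sigma> b \<and> generic_over U P' G' \<longrightarrow>
          (let M = Lev A \<chi>; c = check P in
            \<exists>p. p \<epsilon> carrier P \<and>
              forces P
                (\<^bold>\<exists>\<sigma>'. lifts (c U) (c Q) (c M) (c (intersection A M))
                        (c (opair P' b')) (c (opair P b)) (c G') (generic_name P) \<sigma>'
                      \<^bold>\<and> same_hull (c M) (c (intersection A M)) (c (density P)) (c \<sigma>) \<sigma>') p))"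

definition subcomplete :: "'v \<Rightarrow> bool" where
  "subcomplete P \<longleftrightarrow> (\<exists>\<theta> a. verifies_subcomplete P \<theta> a)"


subsection \<open>Forcing axioms\<close>

definition forcing_axiom_for :: "('v \<Rightarrow> bool) \<Rightarrow> bool" where
  "forcing_axiom_for \<Gamma> \<longleftrightarrow> (\<forall>P F. forcing_notion P \<and> \<Gamma> P
     \<and> (\<forall>D. D \<epsilon> F \<longrightarrow> dense P D) \<and> (\<exists>f. \<Turnstile> is_inj f F omega1) \<longrightarrow>
       (\<exists>g. filter_on P g \<and> (\<forall>D. D \<epsilon> F \<longrightarrow> (\<exists>p. p \<epsilon> g \<and> p \<epsilon> D))))"

definition SCFA :: bool where
  "SCFA \<longleftrightarrow> forcing_axiom_for subcomplete"

definition K_SCFA :: "'v \<Rightarrow> bool" where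
  "K_SCFA K \<longleftrightarrow> forcing_axiom_for (K_subcomplete K)"

end

end

theory Submission
  imports Defs
begin

text \<open>
  Every subcomplete forcing notion is \<open>K\<close>-subcomplete, with the same witnesses. Indeed a
  \<open>K\<close>-good model is countable in a transitive model \<open>k\<close>, hence countable, because ``\<open>f\<close> is an
  injection of \<open>U\<close> into \<open>\<omega>\<close>'' is absolute for transitive sets; and the condition given by
  subcompleteness forces more than \<open>K\<close>-subcompleteness requires, namely also the equality of hulls.
\<close>

context set_universe
begin

text \<open>Pairing gives existence, extensionality uniqueness. This is what makes the definite
  description \<open>opair\<close> denote an actual ordered pair.\<close>

lemma ex1_is_pair:
  assumes "finite_axioms (\<lambda>_. True)"
  shows "\<exists>!z. \<Turnstile> is_pair a b z"
proof -
  have ext: "x = y" if "\<And>z. z \<epsilon> x \<longleftrightarrow> z \<epsilon> y" for x y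
    using assms that by (auto simp: finite_axioms_def ax_extensionality_def)
  have upair: "\<exists>z. \<Turnstile> is_upair x y z" for x y
    using assms by (auto simp: finite_axioms_def ax_pairing_def)
  have upair_unique: "z = z'" if "\<Turnstile> is_upair x y z" "\<Turnstile> is_upair x y z'" for x y z z'
    using that by (intro ext) (auto simp: is_upair_def)
  obtain u v z where "\<Turnstile> is_upair a a u" "\<Turnstile> is_upair a b v" "\<Turnstile> is_upair u v z"
    using upair by meson
  then show ?thesis
    using upair_unique by (auto simp: is_pair_def) metis
qed

lemma is_pair_opair:
  assumes "finite_axioms (\<lambda>_. True)"
  shows "\<Turnstile> is_pair a b (opair a b)"
  unfolding opair_def using ex1_is_pair[OF assms] by (rule theI')

lemma trans_memD: "\<Turnstile> is_trans k \<Longrightarrow> x \<epsilon> y \<Longrightarrow> y \<epsilon> k \<Longrightarrow> x \<epsilon> k"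
  by (auto simp: is_trans_def is_sub_def)

text \<open>The components of a Kuratowski pair lie two membership steps below it, so transitivity
  of \<open>k\<close> applied twice reaches them.\<close>

lemma is_pair_components_mem:
  assumes "\<Turnstile> is_trans k" "\<Turnstile> is_pair a b z" "z \<epsilon> k"
  shows "a \<epsilon> k" "b \<epsilon> k"
  using assms(2,3) trans_memD[OF assms(1)] by (auto simp: is_pair_def is_upair_def) metis+

lemma is_upair_absolute:
  assumes "\<Turnstile> is_trans k" "a \<epsilon> k" "b \<epsilon> k" "z \<epsilon> k"
  shows "holds_in_set k (is_upair a b z) \<longleftrightarrow> (\<Turnstile> is_upair a b z)"
  using assms(2-) trans_memD[OF assms(1)] by (auto simp: is_upair_def)

lemma is_pair_absolute:
  assumes "\<Turnstile> is_trans k" "a \<epsilon> k" "b \<epsilon> k" "z \<epsilon> k"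
  shows "holds_in_set k (is_pair a b z) \<longleftrightarrow> (\<Turnstile> is_pair a b z)"
proof -
  \<comment> \<open>The singleton and doubleton sought by the existential quantifiers are members of
    \<open>z\<close>, so relativizing these quantifiers to \<open>k\<close> loses no
    witness.\<close>
  have "u \<epsilon> k \<and> v \<epsilon> k" if "\<Turnstile> is_upair u v z" for u v
    using that trans_memD[OF assms(1) _ assms(4)] by (auto simp: is_upair_def)
  then show ?thesis
    using assms by (auto simp: is_pair_def is_upair_absolute)
qed

lemma app_absolute:
  assumes "\<Turnstile> is_trans k" "f \<epsilon> k" "x \<epsilon> k" "y \<epsilon> k"
  shows "holds_in_set k (app f x y) \<longleftrightarrow> (\<Turnstile> app f x y)"
  using assms trans_memD[OF assms(1)] by (auto simp: app_def is_pair_absolute)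

text \<open>Quantifiers over arguments and values of \<open>f\<close> carry no syntactic bound; this
  lemma lets them be treated as bounded by \<open>k\<close>.\<close>

lemma app_arguments_mem:
  assumes "\<Turnstile> is_trans k" "f \<epsilon> k" "\<Turnstile> app f x y"
  shows "x \<epsilon> k" "y \<epsilon> k"
  using assms trans_memD[OF assms(1)] is_pair_components_mem[OF assms(1)]
  by (auto simp: app_def)

lemma is_fun_absolute:
  assumes "\<Turnstile> is_trans k" "f \<epsilon> k" "a \<epsilon> k" "b \<epsilon> k"
  shows "holds_in_set k (is_fun f a b) \<longleftrightarrow> (\<Turnstile> is_fun f a b)"
proof -
  note mem = trans_memD[OF assms(1) _ assms(2)] trans_memD[OF assms(1) _ assms(3)]
    trans_memD[OF assms(1) _ assms(4)]
  have "holds_in_set k (\<^bold>\<forall>z. z \<^bold>\<in> f \<^bold>\<longrightarrow> (\<^bold>\<exists>x. \<^bold>\<exists>y. x \<^bold>\<in> a \<^bold>\<and> y \<^bold>\<in> b \<^bold>\<and> is_pair x y z)) \<longleftrightarrow>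
      (\<Turnstile> (\<^bold>\<forall>z. z \<^bold>\<in> f \<^bold>\<longrightarrow> (\<^bold>\<exists>x. \<^bold>\<exists>y. x \<^bold>\<in> a \<^bold>\<and> y \<^bold>\<in> b \<^bold>\<and> is_pair x y z)))"
    using mem by simp (metis is_pair_absolute[OF assms(1)])
  \<comment> \<open>Here \<open>y\<close> and \<open>y'\<close> range over everything, but as values
    of \<open>f\<close> they can only be elements of \<open>k\<close>.\<close>
  moreover have
    "holds_in_set k (\<^bold>\<forall>x. x \<^bold>\<in> a \<^bold>\<longrightarrow> (\<^bold>\<exists>y. app f x y \<^bold>\<and> (\<^bold>\<forall>y'. app f x y' \<^bold>\<longrightarrow> y' \<^bold>= y))) \<longleftrightarrow>
      (\<Turnstile> (\<^bold>\<forall>x. x \<^bold>\<in> a \<^bold>\<longrightarrow> (\<^bold>\<exists>y. app f x y \<^bold>\<and> (\<^bold>\<forall>y'. app f x y' \<^bold>\<longrightarrow> y' \<^bold>= y))))"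
    using mem
    by simp (metis app_absolute[OF assms(1,2)] app_arguments_mem[OF assms(1,2)])
  ultimately show ?thesis
    by (simp add: is_fun_def)
qed

lemma is_inj_absolute:
  assumes "\<Turnstile> is_trans k" "f \<epsilon> k" "a \<epsilon> k" "b \<epsilon> k"
  shows "holds_in_set k (is_inj f a b) \<longleftrightarrow> (\<Turnstile> is_inj f a b)"
  unfolding is_inj_def using is_fun_absolute[OF assms]
  by simp (metis app_absolute[OF assms(1,2)] app_arguments_mem[OF assms(1,2)])

lemma is_empty_absolute:
  assumes "\<Turnstile> is_trans k" "x \<epsilon> k"
  shows "holds_in_set k (is_empty x) \<longleftrightarrow> (\<Turnstile> is_empty x)"
  using assms(2) trans_memD[OF assms(1)] by (auto simp: is_empty_def)

lemma is_trans_absolute: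
  assumes "\<Turnstile> is_trans k" "x \<epsilon> k"
  shows "holds_in_set k (is_trans x) \<longleftrightarrow> (\<Turnstile> is_trans x)"
  using assms(2) trans_memD[OF assms(1)] by (simp add: is_trans_def is_sub_def) blast

lemma is_ord_absolute:
  assumes "\<Turnstile> is_trans k" "x \<epsilon> k"
  shows "holds_in_set k (is_ord x) \<longleftrightarrow> (\<Turnstile> is_ord x)"
  using assms is_trans_absolute[OF assms(1)] trans_memD[OF assms(1) _ assms(2)]
  by (auto simp: is_ord_def)

lemma is_succ_absolute:
  assumes "\<Turnstile> is_trans k" "x \<epsilon> k" "y \<epsilon> k"
  shows "holds_in_set k (is_succ x y) \<longleftrightarrow> (\<Turnstile> is_succ x y)"
  using assms(2-) trans_memD[OF assms(1)] by (auto simp: is_succ_def)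

lemma is_omega_absolute:
  assumes "\<Turnstile> is_trans k" "w \<epsilon> k"
  shows "holds_in_set k (is_omega w) \<longleftrightarrow> (\<Turnstile> is_omega w)"
proof -
  \<comment> \<open>The quantifier over predecessors is the only unbounded one. It is harmless
    because \<open>m\<close> belongs to its successor \<open>n\<close>, which belongs to
    \<open>w\<close>.\<close>
  have pred_mem: "m \<epsilon> k" if "n \<epsilon> w" "\<Turnstile> is_succ m n" for m n
    using that assms(2) trans_memD[OF assms(1)] by (auto simp: is_succ_def)
  have "holds_in_set k (\<^bold>\<forall>n. n \<^bold>\<in> w \<^bold>\<longrightarrow> (\<^bold>\<exists>m. m \<^bold>\<in> w \<^bold>\<and> n \<^bold>\<in> m)) \<longleftrightarrow>
      (\<Turnstile> (\<^bold>\<forall>n. n \<^bold>\<in> w \<^bold>\<longrightarrow> (\<^bold>\<exists>m. m \<^bold>\<in> w \<^bold>\<and> n \<^bold>\<in> m)))"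
    using trans_memD[OF assms(1) _ assms(2)] by simp blast
  moreover have "holds_in_set k (\<^bold>\<forall>n. n \<^bold>\<in> w \<^bold>\<longrightarrow> is_empty n \<^bold>\<or> (\<^bold>\<exists>m. is_succ m n)) \<longleftrightarrow>
      (\<Turnstile> (\<^bold>\<forall>n. n \<^bold>\<in> w \<^bold>\<longrightarrow> is_empty n \<^bold>\<or> (\<^bold>\<exists>m. is_succ m n)))"
    using trans_memD[OF assms(1) _ assms(2)] pred_mem
    by simp (metis is_empty_absolute[OF assms(1)] is_succ_absolute[OF assms(1)])
  ultimately show ?thesis
    by (simp add: is_omega_def is_ord_absolute[OF assms] is_empty_absolute[OF assms])
qed

text \<open>The injection and the \<open>\<omega>\<close> found in \<open>k\<close> keep their
  defining properties in the universe. Only this direction is claimed, since an injection in the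
  universe may be missing from \<open>k\<close>.\<close>

lemma is_countable_upward:
  assumes "\<Turnstile> is_trans k" "x \<epsilon> k" "holds_in_set k (is_countable x)"
  shows "\<Turnstile> is_countable x"
  using assms is_omega_absolute[OF assms(1)] is_inj_absolute[OF assms(1) _ assms(2)]
  by (auto simp: is_countable_def)

lemma K_good_countable:
  assumes "finite_axioms (\<lambda>_. True)" "adequate K" "K_good K U Q"
  shows "\<Turnstile> is_countable U"
proof -
  obtain k where k: "K_at K U k" "opair U Q \<epsilon> k" "holds_in_set k (is_countable U)"
    using assms(3) by (auto simp: K_good_def)
  \<comment> \<open>\<open>k\<close> is a value of the sequence \<open>K\<close>, so adequacy
    applies to it.\<close>
  have trans: "\<Turnstile> is_trans k"
    using assms(2) k(1) by (auto simp: K_at_def adequate_def)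
  \<comment> \<open>Goodness places the pair \<open>opair U Q\<close> in \<open>k\<close>;
    transitivity then puts \<open>U\<close> itself there, as absoluteness with parameter
    \<open>U\<close> demands.\<close>
  show ?thesis
    using is_countable_upward[OF trans _ k(3)]
      is_pair_components_mem(1)[OF trans is_pair_opair[OF assms(1)] k(2)] by blast
qed

text \<open>With the existential read as a negated universal, \<open>p\<close> forces it iff every
  \<open>q\<close> below \<open>p\<close> has some \<open>r\<close> below it forcing an instance at
  a name. The instance is forced at \<open>r\<close> rather than at \<open>p\<close>, hence the
  assumption for arbitrary conditions.\<close>

lemma forces_Ex_mono:
  assumes "forces P (\<^bold>\<exists>x. F x) p" "\<And>x q. forces P (F x) q \<Longrightarrow> forces P (G x) q"
  shows "forces P (\<^bold>\<exists>x. G x) p"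
  using assms by simp blast

lemma subcomplete_imp_K_subcomplete:
  assumes "finite_axioms (\<lambda>_. True)" "adequate K" "subcomplete P"
  shows "K_subcomplete K P"
proof -
  obtain \<theta> a where v: "verifies_subcomplete P \<theta> a"
    using assms(3) by (auto simp: subcomplete_def)
  have "verifies_K_subcomplete K P \<theta> a"
    unfolding verifies_K_subcomplete_def Let_def
  proof (intro conjI allI impI)
    show "regular \<theta>" "in_H \<theta> a" "in_H \<theta> P"
      using v by (auto simp: verifies_subcomplete_def)
    fix A \<chi> U Q P' b' \<sigma> b G'
    assume *: "K_good K U Q \<and> embedding_setup P \<theta> a A \<chi> U Q P' b' \<sigma> b
      \<and> generic_over U P' G' \<and> (\<exists>k. K_at K U k \<and> G' \<epsilon> k)"
    then have "full_model U Q" "\<Turnstile> is_countable U"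
      using K_good_countable[OF assms(1,2)] by (auto simp: K_good_def)
    with v * obtain p where p: "p \<epsilon> carrier P" "forces P
        (\<^bold>\<exists>\<sigma>'. lifts (check P U) (check P Q) (check P (Lev A \<chi>))
            (check P (intersection A (Lev A \<chi>))) (check P (opair P' b')) (check P (opair P b))
            (check P G') (generic_name P) \<sigma>'
          \<^bold>\<and> same_hull (check P (Lev A \<chi>)) (check P (intersection A (Lev A \<chi>)))
            (check P (density P)) (check P \<sigma>) \<sigma>') p"
      unfolding verifies_subcomplete_def Let_def by blast
    have "forces P (\<^bold>\<exists>\<sigma>'. lifts (check P U) (check P Q) (check P (Lev A \<chi>))
            (check P (intersection A (Lev A \<chi>))) (check P (opair P' b')) (check P (opair P b))
            (check P G') (generic_name P) \<sigma>') p"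
      by (rule forces_Ex_mono[OF p(2)]) (simp only: forces.simps)
    with p(1) show "\<exists>p. p \<epsilon> carrier P \<and> forces P
        (\<^bold>\<exists>\<sigma>'. lifts (check P U) (check P Q) (check P (Lev A \<chi>))
            (check P (intersection A (Lev A \<chi>))) (check P (opair P' b')) (check P (opair P b))
            (check P G') (generic_name P) \<sigma>') p"
      by blast
  qed
  then show ?thesis
    unfolding K_subcomplete_def by blast
qed

text \<open>\<open>forcing_axiom_for\<close> is antitone in its class of forcing notions, and the
  subcomplete ones form a subclass of the \<open>K\<close>-subcomplete ones.\<close>

lemma SCFA_if_K_SCFA:
  assumes "finite_axioms (\<lambda>_. True)" "adequate K" "K_SCFA K"
  shows "SCFA"
  using assms(3) subcomplete_imp_K_subcomplete[OF assms(1,2)]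
  unfolding SCFA_def K_SCFA_def forcing_axiom_for_def by blast

end

theorem proposition5p3:
  fixes mem :: "'v \<Rightarrow> 'v \<Rightarrow> bool"
  assumes "set_universe.ZFC mem"
    and "\<exists>K. set_universe.adequate mem K \<and> set_universe.K_SCFA mem K"
  shows "set_universe.SCFA mem"
  using assms set_universe.SCFA_if_K_SCFA[of mem] by (auto simp: set_universe.ZFC_def)

end
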